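(* Let $G$ be a finite bipartite graph with color classes $A$ and $B$, and let $b:V(G)\to\mathbb{Z}_{\ge0}$. A set $Z\subseteq V(G)$ is a $b$-verifying set if and only if there exist a normalized lower ideal $\mathcal{I}_A$ and a normalized upper ideal $\mathcal{I}_B$ of the poset $(\mathcal{F},\le_A)$ with $\mathcal{I}_A\cup\mathcal{I}_B=\mathcal{F}$ and $\mathcal{I}_A\cap\mathcal{I}_B=\emptyset$, such that $Z=Z_A\cup Z_B$ where $Z_A=\bigcup_{H\in\mathcal{I}_A}(V(H)\cap A)$ and $Z_B=\bigcup_{H\in\mathcal{I}_B}(V(H)\cap B)$.
   Context: $\delta(v)$: edges incident with $v$. A $b$-matching is $M\subseteq E(G)$ with $|\delta(v)\cap M|\le b(v)$ for all $v$; maximum = largest cardinality. $v$ is $M$-loose if $|\delta(v)\cap M|<b(v)$. An edge is allowed if in some maximum $b$-matching, forbidden otherwise; an allowed edge is inevitable if in every maximum $b$-matching, flexible otherwise. A flexible component is $G[V(K)]$ for $K$ a connected component of $(V(G),\{\text{flexible edges}\})$; $\mathcal{F}$ is the set of these. $\mathcal{D}$: vertices that are $M$-loose for some maximum $b$-matching $M$. $C\in\mathcal{F}$ is loose if $V(C)\cap\mathcal{D}\ne\emptyset$. $v$ is inactive if $b(v)=0$, and then $G[\{v\}]\in\mathcal{F}$ is called inactive. For $W\in\{A,B\}$, $C\in\mathcal{F}$ is inconsistent hooked up by $W$ if either $C$ is loose with $V(C)\cap\mathcal{D}\cap W\ne\emptyset$, or $C$ is inactive and its vertex has a neighbor in $\mathcal{D}\cap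 W$; $\mathcal{I}_W^{\mathrm{inc}}$ denotes the set of these. $\overline W$ is the other color class. For $C_1,C_2\in\mathcal{F}$, $C_1\preceq^\circ_A C_2$ if $C_1=C_2$, or an inevitable edge joins $V(C_1)\cap A$ to $V(C_2)\cap B$, or a forbidden edge joins $V(C_2)\cap A$ to $V(C_1)\cap B$; $C_1\le_A C_2$ if there are $D_1=C_1,D_2,\dots,D_k=C_2$ in $\mathcal{F}$ with $D_i\preceq^\circ_A D_{i+1}$ for all $i$ (this is a partial order). A lower ideal $\mathcal{I}$ of $(\mathcal{F},\le_A)$ is normalized if $\mathcal{I}_A^{\mathrm{inc}}\subseteq\mathcal{I}$ and $\mathcal{I}_B^{\mathrm{inc}}\cap\mathcal{I}=\emptyset$; an upper ideal $\mathcal{J}$ is normalized if $\mathcal{I}_A^{\mathrm{inc}}\cap\mathcal{J}=\emptyset$ and $\mathcal{I}_B^{\mathrm{inc}}\subseteq\mathcal{J}$. For $Z\subseteq V(G)$, $E[Z]$ is the set of edges with both ends in $Z$, and $b(X)=\sum_{v\in X}b(v)$. $Z$ is a $b$-verifying set if $b(V(G)\setminus Z)+|E[Z]|$ equals the size of a maximum $b$-matching (this is the minimum of $b(V(G)\setminus Z)+|E[Z]|$ over all $Z$). *)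

theory Defs
  imports Main
begin

(* Parallel edges are admitted: edges are abstract, and "ends" gives the set of end vertices.
   A simple graph is the case where edges are two-element vertex sets and "ends" is the identity. *)
record ('v, 'e) graph =
  verts :: "'v set"
  edges :: "'e set"
  ends :: "'e \<Rightarrow> 'v set"

definition finite_bipartite_graph :: "('v, 'e) graph \<Rightarrow> 'v set \<Rightarrow> 'v set \<Rightarrow> bool" where
  "finite_bipartite_graph G A B \<longleftrightarrow>
     finite (verts G) \<and> finite (edges G) \<and> A \<union> B = verts G \<and> A \<inter> B = {} \<and>
     (\<forall>e\<in>edges G. \<exists>x\<in>A. \<exists>y\<in>B. ends G e = {x, y})"

definition edges_within :: "('v, 'e) graph \<Rightarrow> 'v set \<Rightarrow> 'e set" where
  "edges_within G X = {e \<in> edges G. ends G e \<subseteq> X}"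

definition induced_subgraph :: "('v, 'e) graph \<Rightarrow> 'v set \<Rightarrow> ('v, 'e) graph" where
  "induced_subgraph G X = \<lparr>verts = X, edges = edges_within G X, ends = ends G\<rparr>"

definition incident_edges :: "('v, 'e) graph \<Rightarrow> 'v \<Rightarrow> 'e set" where
  "incident_edges G v = {e \<in> edges G. v \<in> ends G e}"

definition adjacent :: "('v, 'e) graph \<Rightarrow> 'v \<Rightarrow> 'v \<Rightarrow> bool" where
  "adjacent G u v \<longleftrightarrow> (\<exists>e\<in>edges G. ends G e = {u, v})"

definition connected_components :: "('v, 'e) graph \<Rightarrow> ('v, 'e) graph set" where
  "connected_components G =
     {induced_subgraph G {u \<in> verts G. (adjacent G)\<^sup>*\<^sup>* v u} |v. v \<in> verts G}"

definition b_matching :: "('v, 'e) graph \<Rightarrow> ('v \<Rightarrow> nat) \<Rightarrow> 'e set \<Rightarrow> bool" where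
  "b_matching G b M \<longleftrightarrow>
     M \<subseteq> edges G \<and> (\<forall>v\<in>verts G. card (incident_edges G v \<inter> M) \<le> b v)"

definition max_b_matching_size :: "('v, 'e) graph \<Rightarrow> ('v \<Rightarrow> nat) \<Rightarrow> nat" where
  "max_b_matching_size G b = Max (card ` {M. b_matching G b M})"

definition maximum_b_matching :: "('v, 'e) graph \<Rightarrow> ('v \<Rightarrow> nat) \<Rightarrow> 'e set \<Rightarrow> bool" where
  "maximum_b_matching G b M \<longleftrightarrow> b_matching G b M \<and> card M = max_b_matching_size G b"

definition loose_vertex :: "('v, 'e) graph \<Rightarrow> ('v \<Rightarrow> nat) \<Rightarrow> 'e set \<Rightarrow> 'v \<Rightarrow> bool" where
  "loose_vertex G b M v \<longleftrightarrow> card (incident_edges G v \<inter> M) < b v"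

definition allowed_edges :: "('v, 'e) graph \<Rightarrow> ('v \<Rightarrow> nat) \<Rightarrow> 'e set" where
  "allowed_edges G b = {e \<in> edges G. \<exists>M. maximum_b_matching G b M \<and> e \<in> M}"

definition forbidden_edges :: "('v, 'e) graph \<Rightarrow> ('v \<Rightarrow> nat) \<Rightarrow> 'e set" where
  "forbidden_edges G b = edges G - allowed_edges G b"

definition inevitable_edges :: "('v, 'e) graph \<Rightarrow> ('v \<Rightarrow> nat) \<Rightarrow> 'e set" where
  "inevitable_edges G b =
     {e \<in> allowed_edges G b. \<forall>M. maximum_b_matching G b M \<longrightarrow> e \<in> M}"

definition flexible_edges :: "('v, 'e) graph \<Rightarrow> ('v \<Rightarrow> nat) \<Rightarrow> 'e set" where
  "flexible_edges G b = allowed_edges G b - inevitable_edges G b"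

definition flexible_components :: "('v, 'e) graph \<Rightarrow> ('v \<Rightarrow> nat) \<Rightarrow> ('v, 'e) graph set" where
  "flexible_components G b =
     {induced_subgraph G (verts K) |K.
        K \<in> connected_components (G\<lparr>edges := flexible_edges G b\<rparr>)}"

definition D_set :: "('v, 'e) graph \<Rightarrow> ('v \<Rightarrow> nat) \<Rightarrow> 'v set" where
  "D_set G b = {v \<in> verts G. \<exists>M. maximum_b_matching G b M \<and> loose_vertex G b M v}"

definition loose_component :: "('v, 'e) graph \<Rightarrow> ('v \<Rightarrow> nat) \<Rightarrow> ('v, 'e) graph \<Rightarrow> bool" where
  "loose_component G b C \<longleftrightarrow> verts C \<inter> D_set G b \<noteq> {}"

definition inactive_vertex :: "('v \<Rightarrow> nat) \<Rightarrow> 'v \<Rightarrow> bool" where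
  "inactive_vertex b v \<longleftrightarrow> b v = 0"

definition inconsistent_hooked_up ::
    "('v, 'e) graph \<Rightarrow> ('v \<Rightarrow> nat) \<Rightarrow> 'v set \<Rightarrow> ('v, 'e) graph set" where
  "inconsistent_hooked_up G b W =
     {C \<in> flexible_components G b.
        (loose_component G b C \<and> verts C \<inter> D_set G b \<inter> W \<noteq> {}) \<or>
        (\<exists>v\<in>verts G. inactive_vertex b v \<and> C = induced_subgraph G {v} \<and>
           (\<exists>u \<in> D_set G b \<inter> W. adjacent G v u))}"

definition joins :: "('v, 'e) graph \<Rightarrow> 'e \<Rightarrow> 'v set \<Rightarrow> 'v set \<Rightarrow> bool" where
  "joins G e X Y \<longleftrightarrow> (\<exists>x\<in>X. \<exists>y\<in>Y. ends G e = {x, y})"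

definition prec_comp ::
    "('v, 'e) graph \<Rightarrow> ('v \<Rightarrow> nat) \<Rightarrow> 'v set \<Rightarrow> 'v set \<Rightarrow> ('v, 'e) graph \<Rightarrow> ('v, 'e) graph \<Rightarrow> bool" where
  "prec_comp G b A B C1 C2 \<longleftrightarrow>
     C1 \<in> flexible_components G b \<and> C2 \<in> flexible_components G b \<and>
     (C1 = C2 \<or>
      (\<exists>e\<in>inevitable_edges G b. joins G e (verts C1 \<inter> A) (verts C2 \<inter> B)) \<or>
      (\<exists>e\<in>forbidden_edges G b. joins G e (verts C2 \<inter> A) (verts C1 \<inter> B)))"

(* prec_comp is reflexive on the flexible components, so its transitive closure
   also covers the one-element chains. *)
definition le_comp ::
    "('v, 'e) graph \<Rightarrow> ('v \<Rightarrow> nat) \<Rightarrow> 'v set \<Rightarrow> 'v set \<Rightarrow> ('v, 'e) graph \<Rightarrow> ('v, 'e) graph \<Rightarrow> bool" where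
  "le_comp G b A B = (prec_comp G b A B)\<^sup>+\<^sup>+"

definition lower_ideal :: "'a set \<Rightarrow> ('a \<Rightarrow> 'a \<Rightarrow> bool) \<Rightarrow> 'a set \<Rightarrow> bool" where
  "lower_ideal P le I \<longleftrightarrow> I \<subseteq> P \<and> (\<forall>y\<in>I. \<forall>x\<in>P. le x y \<longrightarrow> x \<in> I)"

definition upper_ideal :: "'a set \<Rightarrow> ('a \<Rightarrow> 'a \<Rightarrow> bool) \<Rightarrow> 'a set \<Rightarrow> bool" where
  "upper_ideal P le J \<longleftrightarrow> J \<subseteq> P \<and> (\<forall>x\<in>J. \<forall>y\<in>P. le x y \<longrightarrow> y \<in> J)"

definition normalized_lower_ideal ::
    "('v, 'e) graph \<Rightarrow> ('v \<Rightarrow> nat) \<Rightarrow> 'v set \<Rightarrow> 'v set \<Rightarrow> ('v, 'e) graph set \<Rightarrow> bool" where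
  "normalized_lower_ideal G b A B I \<longleftrightarrow>
     lower_ideal (flexible_components G b) (le_comp G b A B) I \<and>
     inconsistent_hooked_up G b A \<subseteq> I \<and> inconsistent_hooked_up G b B \<inter> I = {}"

definition normalized_upper_ideal ::
    "('v, 'e) graph \<Rightarrow> ('v \<Rightarrow> nat) \<Rightarrow> 'v set \<Rightarrow> 'v set \<Rightarrow> ('v, 'e) graph set \<Rightarrow> bool" where
  "normalized_upper_ideal G b A B J \<longleftrightarrow>
     upper_ideal (flexible_components G b) (le_comp G b A B) J \<and>
     inconsistent_hooked_up G b A \<inter> J = {} \<and> inconsistent_hooked_up G b B \<subseteq> J"

definition b_verifying :: "('v, 'e) graph \<Rightarrow> ('v \<Rightarrow> nat) \<Rightarrow> 'v set \<Rightarrow> bool" where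
  "b_verifying G b Z \<longleftrightarrow>
     sum b (verts G - Z) + card (edges_within G Z) = max_b_matching_size G b"

end

(* Every edge of a b-matching M meets V - Z or lies in E[Z], so |M| \<le> b(V - Z) + |E[Z]|, and
   the gap counts the edges of M inside V - Z, the unused capacity on V - Z, and the edges of
   E[Z] missing from M.  Hence Z is b-verifying iff D \<subseteq> Z, all edges inside V - Z are
   forbidden and all edges inside Z are inevitable.  Then flexible edges cross between Z and its
   complement, so on each flexible component Z is exactly one of the two color classes; this
   choice is the partition into the two ideals, and the remaining conditions on inevitable and
   forbidden edges say precisely that the choice is closed under the order. *)
theory Submission
  imports Defs
begin

section \<open>The slack in the upper bound, and when it vanishes\<close>

text \<open>Double counting of incidences between \<open>M\<close> and \<open>verts G - Z\<close>:
  an edge of \<open>M\<close> contributes 0, 1 or 2 according to whether it lies inside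
  \<open>Z\<close>, crosses, or lies inside the complement. The gap stands on the left, so that its
  vanishing can be read off term by term.\<close>

lemma b_matching_gap:
  assumes G: "finite_bipartite_graph G A B" and "Z \<subseteq> verts G" and M: "b_matching G b M"
  shows "card M + (card (M \<inter> edges_within G (verts G - Z)) +
      (\<Sum>v\<in>verts G - Z. b v - card (incident_edges G v \<inter> M)) + card (edges_within G Z - M)) =
    sum b (verts G - Z) + card (edges_within G Z)"
proof -
  define Y where "Y = verts G - Z"
  have fin: "finite Y" "finite (edges G)" and ME: "M \<subseteq> edges G"
    using G M by (auto simp: finite_bipartite_graph_def b_matching_def Y_def)
  then have finM: "finite M" by (auto intro: finite_subset)
  have finZ: "finite (edges_within G Z)" using fin by (simp add: edges_within_def)
  have ends: "card (Y \<inter> ends G e) =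
      (if e \<in> edges_within G Z then 0 else 1) + (if e \<in> edges_within G Y then 1 else 0)"
    if "e \<in> M" for e
  proof -
    have eE: "e \<in> edges G" using that ME by auto
    then obtain x y where xy: "x \<in> A" "y \<in> B" "ends G e = {x, y}"
      using G by (auto simp: finite_bipartite_graph_def)
    \<comment> \<open>Bipartiteness rules out loops: a loop in \<open>Y\<close> would have one end
      there, while the right-hand side counts two.\<close>
    then have "x \<noteq> y" "x \<in> verts G" "y \<in> verts G"
      using G by (auto simp: finite_bipartite_graph_def)
    then show ?thesis using xy eE
      by (cases "x \<in> Z"; cases "y \<in> Z") (auto simp: edges_within_def Y_def Int_insert_right)
  qed
  have "(\<Sum>v\<in>Y. card (incident_edges G v \<inter> M)) = (\<Sum>v\<in>Y. \<Sum>e\<in>M. if v \<in> ends G e then 1 else 0)"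
  proof (rule sum.cong)
    fix v
    have "incident_edges G v \<inter> M = {e \<in> M. v \<in> ends G e}"
      using ME by (auto simp: incident_edges_def)
    then show "card (incident_edges G v \<inter> M) = (\<Sum>e\<in>M. if v \<in> ends G e then 1 else 0)"
      using finM by (simp flip: sum.inter_filter)
  qed simp
  also have "\<dots> = (\<Sum>e\<in>M. card (Y \<inter> ends G e))"
    using fin by (subst sum.swap) (simp add: Int_def flip: sum.inter_filter)
  also have "\<dots> = (\<Sum>e\<in>M. (if e \<in> edges_within G Z then 0 else 1) +
      (if e \<in> edges_within G Y then 1 else 0))"
    using ends by simp
  also have "\<dots> = card (M - edges_within G Z) + card (M \<inter> edges_within G Y)"
  proof -
    have "(\<Sum>e\<in>M. if e \<in> edges_within G Z then 0 else 1::nat) =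
        (\<Sum>e\<in>M. if e \<notin> edges_within G Z then 1 else 0)"
      by (rule sum.cong) auto
    then show ?thesis
      using finM by (simp add: sum.distrib set_diff_eq Int_def flip: sum.inter_filter)
  qed
  finally have deg: "(\<Sum>v\<in>Y. card (incident_edges G v \<inter> M)) =
      card (M - edges_within G Z) + card (M \<inter> edges_within G Y)" .
  \<comment> \<open>The subtraction of naturals is exact here because a b-matching respects every
    capacity.\<close>
  have "(\<Sum>v\<in>Y. b v - card (incident_edges G v \<inter> M)) +
      (\<Sum>v\<in>Y. card (incident_edges G v \<inter> M)) = sum b Y"
    unfolding sum.distrib[symmetric] using M by (intro sum.cong) (auto simp: b_matching_def Y_def)
  moreover have "card M = card (M - edges_within G Z) + card (M \<inter> edges_within G Z)"
    using finM card_Int_Diff[of M "edges_within G Z"] by simp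
  moreover have "card (edges_within G Z) =
      card (edges_within G Z - M) + card (M \<inter> edges_within G Z)"
    using finZ card_Int_Diff[of "edges_within G Z" M] by (simp add: Int_commute)
  ultimately show ?thesis using deg unfolding Y_def by linarith
qed

lemma maximum_b_matching_exists:
  assumes "finite (edges G)"
  shows "\<exists>M. maximum_b_matching G b M"
proof -
  have "finite {M. b_matching G b M}"
    by (rule finite_subset[of _ "Pow (edges G)"]) (use assms in \<open>auto simp: b_matching_def\<close>)
  moreover have "b_matching G b {}" by (simp add: b_matching_def)
  ultimately have "Max (card ` {M. b_matching G b M}) \<in> card ` {M. b_matching G b M}"
    by (intro Max_in) auto
  then show ?thesis by (auto simp: maximum_b_matching_def max_b_matching_size_def)
qed

text \<open>For a maximum \<open>M\<close> the gap is exactly the excess of the bound for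
  \<open>Z\<close> over the optimum, and a sum of naturals is zero only if every summand is.\<close>

lemma b_verifying_iff_tight:
  assumes G: "finite_bipartite_graph G A B" and Z: "Z \<subseteq> verts G" and M: "maximum_b_matching G b M"
  shows "b_verifying G b Z \<longleftrightarrow> M \<inter> edges_within G (verts G - Z) = {} \<and>
    (\<forall>v\<in>verts G - Z. \<not> loose_vertex G b M v) \<and> edges_within G Z \<subseteq> M"
proof -
  have bM: "b_matching G b M" and size: "card M = max_b_matching_size G b"
    using M by (auto simp: maximum_b_matching_def)
  have fin: "finite (verts G)" "finite (edges G)" using G by (auto simp: finite_bipartite_graph_def)
  then have "finite M" "finite (edges_within G Z)"
    using bM by (auto simp: b_matching_def edges_within_def intro: finite_subset)
  moreover have "b_verifying G b Z \<longleftrightarrow> card (M \<inter> edges_within G (verts G - Z)) +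
      (\<Sum>v\<in>verts G - Z. b v - card (incident_edges G v \<inter> M)) + card (edges_within G Z - M) = 0"
    using b_matching_gap[OF G Z bM] size unfolding b_verifying_def by linarith
  ultimately show ?thesis using fin by (auto simp: loose_vertex_def not_less)
qed

lemma b_verifying_iff:
  assumes G: "finite_bipartite_graph G A B" and Z: "Z \<subseteq> verts G"
  shows "b_verifying G b Z \<longleftrightarrow> D_set G b \<subseteq> Z \<and>
    edges_within G (verts G - Z) \<subseteq> forbidden_edges G b \<and> edges_within G Z \<subseteq> inevitable_edges G b"
proof -
  obtain M where M: "maximum_b_matching G b M"
    using maximum_b_matching_exists[of G b] G by (auto simp: finite_bipartite_graph_def)
  \<comment> \<open>The left side does not mention \<open>M\<close>, so tightness for one maximum
    b-matching is tightness for all; that one exists keeps the quantifier from being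
    vacuous.\<close>
  have "b_verifying G b Z \<longleftrightarrow> (\<forall>M. maximum_b_matching G b M \<longrightarrow>
      M \<inter> edges_within G (verts G - Z) = {} \<and>
      (\<forall>v\<in>verts G - Z. \<not> loose_vertex G b M v) \<and> edges_within G Z \<subseteq> M)"
    using b_verifying_iff_tight[OF G Z] M by metis
  also have "\<dots> \<longleftrightarrow>
      (\<forall>M. maximum_b_matching G b M \<longrightarrow> M \<inter> edges_within G (verts G - Z) = {}) \<and>
      (\<forall>M. maximum_b_matching G b M \<longrightarrow> (\<forall>v\<in>verts G - Z. \<not> loose_vertex G b M v)) \<and>
      (\<forall>M. maximum_b_matching G b M \<longrightarrow> edges_within G Z \<subseteq> M)"
    by meson
  also have "(\<forall>M. maximum_b_matching G b M \<longrightarrow> M \<inter> edges_within G (verts G - Z) = {}) \<longleftrightarrow>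
      edges_within G (verts G - Z) \<subseteq> forbidden_edges G b"
    by (auto simp: forbidden_edges_def allowed_edges_def edges_within_def)
  also have "(\<forall>M. maximum_b_matching G b M \<longrightarrow> (\<forall>v\<in>verts G - Z. \<not> loose_vertex G b M v)) \<longleftrightarrow>
      D_set G b \<subseteq> Z"
    by (auto simp: D_set_def)
  \<comment> \<open>An inevitable edge must also be allowed, which the fixed maximum b-matching
    \<open>M\<close> witnesses.\<close>
  also have "(\<forall>M. maximum_b_matching G b M \<longrightarrow> edges_within G Z \<subseteq> M) \<longleftrightarrow>
      edges_within G Z \<subseteq> inevitable_edges G b"
    using M by (auto simp: inevitable_edges_def allowed_edges_def edges_within_def)
  finally show ?thesis by blast
qed

section \<open>Flexible components as classes of vertices\<close>

text \<open>Indexing components by vertices turns lying in the same component into an equation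
  between values.\<close>

definition flexible_component_of :: "('v, 'e) graph \<Rightarrow> ('v \<Rightarrow> nat) \<Rightarrow> 'v \<Rightarrow> ('v, 'e) graph" where
  "flexible_component_of G b v = induced_subgraph G
     {u \<in> verts G. (adjacent (G\<lparr>edges := flexible_edges G b\<rparr>))\<^sup>*\<^sup>* v u}"

lemma verts_flexible_component_of:
  "verts (flexible_component_of G b v) =
    {u \<in> verts G. (adjacent (G\<lparr>edges := flexible_edges G b\<rparr>))\<^sup>*\<^sup>* v u}"
  by (simp add: flexible_component_of_def induced_subgraph_def)

lemma flexible_components_eq_image:
  "flexible_components G b = flexible_component_of G b ` verts G"
  by (simp add: flexible_components_def connected_components_def flexible_component_of_def
      induced_subgraph_def Setcompr_eq_image image_image)

text \<open>Ends are unordered, so adjacency is symmetric and reachability is an equivalence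
  relation.\<close>

lemma flexible_component_of_eqI:
  assumes "u \<in> verts (flexible_component_of G b v)"
  shows "flexible_component_of G b u = flexible_component_of G b v"
proof -
  let ?R = "adjacent (G\<lparr>edges := flexible_edges G b\<rparr>)"
  have "symp ?R" by (auto simp: symp_def adjacent_def insert_commute)
  then have "?R\<^sup>*\<^sup>* u v" "?R\<^sup>*\<^sup>* v u"
    using assms by (auto simp: verts_flexible_component_of dest: symp_rtranclp[THEN sympD])
  then have "?R\<^sup>*\<^sup>* u w \<longleftrightarrow> ?R\<^sup>*\<^sup>* v w" for w
    by (meson rtranclp_trans)
  then show ?thesis by (simp add: flexible_component_of_def)
qed

lemma flexible_component_unique:
  assumes "C \<in> flexible_components G b" and "v \<in> verts C"
  shows "C = flexible_component_of G b v"
proof -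
  obtain u where "C = flexible_component_of G b u"
    using assms(1) by (auto simp: flexible_components_eq_image)
  then show ?thesis using flexible_component_of_eqI assms(2) by metis
qed

lemma flexible_component_of_props:
  assumes "v \<in> verts G"
  shows "flexible_component_of G b v \<in> flexible_components G b"
    and "v \<in> verts (flexible_component_of G b v)"
  using assms by (auto simp: flexible_components_eq_image verts_flexible_component_of)

text \<open>Used in contraposition: an edge between different components is either inevitable or
  forbidden, hence relates them in the order.\<close>

lemma flexible_component_of_edge:
  assumes "e \<in> flexible_edges G b" "ends G e = {x, y}" "x \<in> verts G" "y \<in> verts G"
  shows "flexible_component_of G b x = flexible_component_of G b y"
proof -
  have "adjacent (G\<lparr>edges := flexible_edges G b\<rparr>) x y"
    using assms(1,2) by (simp add: adjacent_def) blast
  then have "y \<in> verts (flexible_component_of G b x)"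
    using assms(4) by (simp add: verts_flexible_component_of r_into_rtranclp)
  then show ?thesis using flexible_component_of_eqI by metis
qed

section \<open>From a verifying set to ideals\<close>

text \<open>A flexible edge is neither forbidden nor inevitable, so exactly one of its ends is in
  \<open>Z\<close>, and exactly one is in \<open>A\<close>. Passing along it flips both memberships
  and keeps their agreement.\<close>

lemma b_verifying_component_side:
  assumes G: "finite_bipartite_graph G A B" and Z: "Z \<subseteq> verts G" and "b_verifying G b Z"
    and C: "C \<in> flexible_components G b"
    and "u \<in> verts C" "w \<in> verts C"
  shows "(u \<in> Z \<longleftrightarrow> u \<in> A) \<longleftrightarrow> (w \<in> Z \<longleftrightarrow> w \<in> A)"
proof -
  let ?R = "adjacent (G\<lparr>edges := flexible_edges G b\<rparr>)"
  have step: "(x \<in> Z \<longleftrightarrow> x \<in> A) \<longleftrightarrow> (y \<in> Z \<longleftrightarrow> y \<in> A)" if R: "?R x y" for x y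
  proof -
    obtain e where e: "e \<in> flexible_edges G b" and "ends G e = {x, y}"
      using R by (auto simp: adjacent_def)
    moreover have "e \<in> edges G" "e \<notin> forbidden_edges G b" "e \<notin> inevitable_edges G b"
      using e by (auto simp: flexible_edges_def allowed_edges_def forbidden_edges_def)
    moreover have "e \<notin> edges_within G Z" "e \<notin> edges_within G (verts G - Z)"
      using calculation assms b_verifying_iff[OF G Z] by auto
    ultimately have cross: "\<not> {x, y} \<subseteq> Z" "\<not> {x, y} \<subseteq> verts G - Z"
      and "ends G e = {x, y}" "e \<in> edges G"
      by (auto simp: edges_within_def)
    then obtain p q where pq: "p \<in> A" "q \<in> B" "{x, y} = {p, q}"
      using G unfolding finite_bipartite_graph_def by metis
    then have "q \<notin> A" "p \<in> verts G" "q \<in> verts G"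
      using G by (auto simp: finite_bipartite_graph_def)
    then show ?thesis
      using cross pq by (auto simp: doubleton_eq_iff)
  qed
  have "C = flexible_component_of G b u"
    using C \<open>u \<in> verts C\<close> by (rule flexible_component_unique)
  with \<open>w \<in> verts C\<close> have "?R\<^sup>*\<^sup>* u w" by (simp add: verts_flexible_component_of)
  then show ?thesis by induction (use step in blast)+
qed

lemma b_verifying_imp_ideals:
  fixes G :: "('v, 'e) graph" and A B Z :: "'v set" and b :: "'v \<Rightarrow> nat"
  assumes G: "finite_bipartite_graph G A B" and Z: "Z \<subseteq> verts G" and ver: "b_verifying G b Z"
  defines "I \<equiv> {C \<in> flexible_components G b. \<forall>u\<in>verts C. u \<in> Z \<longleftrightarrow> u \<in> A}"
  defines "J \<equiv> {C \<in> flexible_components G b. \<forall>u\<in>verts C. u \<in> Z \<longleftrightarrow> u \<notin> A}"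
  shows "normalized_lower_ideal G b A B I" and "normalized_upper_ideal G b A B J"
    and "I \<union> J = flexible_components G b" and "I \<inter> J = {}"
    and "Z = (\<Union>H\<in>I. verts H \<inter> A) \<union> (\<Union>H\<in>J. verts H \<inter> B)"
proof -
  let ?F = "flexible_components G b"
  have AB: "A \<union> B = verts G" "A \<inter> B = {}" using G by (auto simp: finite_bipartite_graph_def)
  have D: "D_set G b \<subseteq> Z" using b_verifying_iff[OF G Z] ver by simp
  have out: "e \<in> forbidden_edges G b" if "e \<in> edges_within G (verts G - Z)" for e
    using b_verifying_iff[OF G Z] ver that by auto
  have inn: "e \<in> inevitable_edges G b" if "e \<in> edges_within G Z" for e
    using b_verifying_iff[OF G Z] ver that by auto
  have edges: "e \<in> edges G" "e \<notin> forbidden_edges G b" if "e \<in> inevitable_edges G b" for e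
    using that by (auto simp: inevitable_edges_def allowed_edges_def forbidden_edges_def)
  have nonempty: "verts C \<noteq> {}" if "C \<in> ?F" for C
    using that by (auto simp: flexible_components_eq_image verts_flexible_component_of)
  have D_sub: "D_set G b \<subseteq> verts G" by (auto simp: D_set_def)
  show un: "I \<union> J = ?F"
    unfolding I_def J_def using b_verifying_component_side[OF G Z ver] by blast
  \<comment> \<open>On an empty component both defining conditions would hold vacuously.\<close>
  show disj: "I \<inter> J = {}"
    unfolding I_def J_def using nonempty by blast
  \<comment> \<open>If \<open>C1\<close> were in \<open>J\<close>, the A-vertices of
    \<open>C1\<close> and the B-vertices of \<open>C2\<close> would avoid \<open>Z\<close>, so an
    inevitable edge between them would be forbidden; the A-vertices of \<open>C2\<close> and the
    B-vertices of \<open>C1\<close> would lie in \<open>Z\<close>, so a forbidden edge between them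
    would be inevitable.\<close>
  have prec: "C1 \<in> I" if "prec_comp G b A B C1 C2" and C2: "C2 \<in> I" for C1 C2
  proof (rule ccontr)
    assume "C1 \<notin> I"
    then have C1: "C1 \<in> J" using un that by (auto simp: prec_comp_def)
    from that(1) consider "C1 = C2"
      | e where "e \<in> inevitable_edges G b" "joins G e (verts C1 \<inter> A) (verts C2 \<inter> B)"
      | e where "e \<in> forbidden_edges G b" "joins G e (verts C2 \<inter> A) (verts C1 \<inter> B)"
      unfolding prec_comp_def by blast
    then show False
    proof cases
      case 1
      then show ?thesis using C1 C2 disj by auto
    next
      case 2
      then have "e \<in> edges_within G (verts G - Z)"
        using C1 C2 AB edges by (fastforce simp: joins_def edges_within_def I_def J_def)
      then show ?thesis using 2 edges out by blast
    next
      case 3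
      then have "e \<in> edges_within G Z"
        using C1 C2 AB
        by (fastforce simp: joins_def edges_within_def I_def J_def forbidden_edges_def)
      then show ?thesis using 3 edges inn by blast
    qed
  qed
  have le: "C1 \<in> I" if "le_comp G b A B C1 C2" "C2 \<in> I" for C1 C2
    using that unfolding le_comp_def by induction (auto intro: prec)
  \<comment> \<open>Since \<open>u\<close> is in \<open>Z\<close>, having \<open>v\<close> there too
    would make the edge inevitable, but no b-matching uses an edge at a vertex of capacity
    0.\<close>
  have inactive: "v \<notin> Z"
    if inactive: "b v = 0" "v \<in> verts G" "u \<in> D_set G b" "adjacent G v u" for u v
  proof
    assume "v \<in> Z"
    obtain e where e: "e \<in> edges G" "ends G e = {v, u}" using inactive by (auto simp: adjacent_def)
    then have "e \<in> inevitable_edges G b"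
      using D that \<open>v \<in> Z\<close> by (intro inn) (auto simp: edges_within_def)
    then obtain M where M: "b_matching G b M" "e \<in> M"
      by (auto simp: inevitable_edges_def allowed_edges_def maximum_b_matching_def)
    have "finite M"
      using M G by (auto simp: b_matching_def finite_bipartite_graph_def intro: finite_subset)
    moreover have "e \<in> incident_edges G v \<inter> M" using e M by (auto simp: incident_edges_def)
    ultimately have "0 < card (incident_edges G v \<inter> M)" by (auto simp: card_gt_0_iff)
    then show False using M that by (auto simp: b_matching_def)
  qed
  have adj: "v \<in> A \<longleftrightarrow> u \<in> B" if vu: "adjacent G v u" for u v
  proof -
    obtain e where "e \<in> edges G" "ends G e = {v, u}" using vu by (auto simp: adjacent_def)
    then obtain p q where "p \<in> A" "q \<in> B" "{v, u} = {p, q}"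
      using G by (auto simp: finite_bipartite_graph_def)
    then show ?thesis using AB by (auto simp: doubleton_eq_iff)
  qed
  \<comment> \<open>A vertex of \<open>D_set G b\<close> in \<open>A\<close> lies in
    \<open>Z\<close>, against membership in \<open>J\<close>. An inactive neighbor of such a vertex
    lies in \<open>B\<close> and outside \<open>Z\<close>, against it as well.\<close>
  have incA: "inconsistent_hooked_up G b A \<inter> J = {}"
    using D AB inactive adj D_sub
    by (fastforce simp: inconsistent_hooked_up_def J_def inactive_vertex_def induced_subgraph_def)
  have incB: "inconsistent_hooked_up G b B \<inter> I = {}"
    using D AB inactive adj D_sub
    by (fastforce simp: inconsistent_hooked_up_def I_def inactive_vertex_def induced_subgraph_def)
  have inc_sub: "inconsistent_hooked_up G b W \<subseteq> ?F" for W
    by (auto simp: inconsistent_hooked_up_def)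
  have "inconsistent_hooked_up G b A \<subseteq> I" using incA un inc_sub by blast
  then show "normalized_lower_ideal G b A B I"
    using incB le un by (auto simp: normalized_lower_ideal_def lower_ideal_def)
  have "inconsistent_hooked_up G b B \<subseteq> J" using incB un inc_sub by blast
  \<comment> \<open>\<open>J\<close> is the complement of \<open>I\<close> among the components, so
    it is closed upward because \<open>I\<close> is closed downward.\<close>
  then show "normalized_upper_ideal G b A B J"
    using incA le un disj unfolding normalized_upper_ideal_def upper_ideal_def by blast
  show "Z = (\<Union>H\<in>I. verts H \<inter> A) \<union> (\<Union>H\<in>J. verts H \<inter> B)"
  proof
    show "(\<Union>H\<in>I. verts H \<inter> A) \<union> (\<Union>H\<in>J. verts H \<inter> B) \<subseteq> Z"
      using AB by (auto simp: I_def J_def)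
    show "Z \<subseteq> (\<Union>H\<in>I. verts H \<inter> A) \<union> (\<Union>H\<in>J. verts H \<inter> B)"
    proof
      fix v assume "v \<in> Z"
      then have "v \<in> verts G" using Z by auto
      note C = flexible_component_of_props[OF this, of b]
      then have "flexible_component_of G b v \<in> I \<union> J" using un by auto
      then show "v \<in> (\<Union>H\<in>I. verts H \<inter> A) \<union> (\<Union>H\<in>J. verts H \<inter> B)"
        using C AB \<open>v \<in> Z\<close> \<open>v \<in> verts G\<close> by (auto simp: I_def J_def)
    qed
  qed
qed

section \<open>From ideals to a verifying set\<close>

text \<open>The three conditions of \<open>b_verifying_iff\<close> are checked: normalization yields
  the one on \<open>D_set G b\<close>, and an edge violating either of the other two would put a
  component of \<open>J\<close> below one of \<open>I\<close>.\<close>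

lemma ideals_imp_b_verifying:
  assumes G: "finite_bipartite_graph G A B" and Z: "Z \<subseteq> verts G"
    and I: "normalized_lower_ideal G b A B I" and J: "normalized_upper_ideal G b A B J"
    and un: "I \<union> J = flexible_components G b" and disj: "I \<inter> J = {}"
    and Z_eq: "Z = (\<Union>H\<in>I. verts H \<inter> A) \<union> (\<Union>H\<in>J. verts H \<inter> B)"
  shows "b_verifying G b Z"
proof -
  let ?c = "flexible_component_of G b"
  have AB: "A \<union> B = verts G" "A \<inter> B = {}" using G by (auto simp: finite_bipartite_graph_def)
  note c = flexible_component_of_props[of _ G b]
  \<comment> \<open>A vertex of \<open>A\<close> can enter \<open>Z\<close> only through the first
    union, and only through the one component containing it.\<close>
  have ZA: "v \<in> Z \<longleftrightarrow> ?c v \<in> I" if v: "v \<in> A" for v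
  proof
    assume "v \<in> Z"
    then obtain H where H: "H \<in> I" "v \<in> verts H" using Z_eq AB v by blast
    then have "H \<in> flexible_components G b" using un by blast
    then show "?c v \<in> I" using H flexible_component_unique by metis
  next
    assume "?c v \<in> I"
    moreover have "v \<in> verts (?c v)" using v AB by (intro c) auto
    ultimately show "v \<in> Z" using v unfolding Z_eq by blast
  qed
  have ZB: "v \<in> Z \<longleftrightarrow> ?c v \<in> J" if v: "v \<in> B" for v
  proof
    assume "v \<in> Z"
    then obtain H where H: "H \<in> J" "v \<in> verts H" using Z_eq AB v by blast
    then have "H \<in> flexible_components G b" using un by blast
    then show "?c v \<in> J" using H flexible_component_unique by metis
  next
    assume "?c v \<in> J"
    moreover have "v \<in> verts (?c v)" using v AB by (intro c) auto
    ultimately show "v \<in> Z" using v unfolding Z_eq by blast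
  qed
  have le: False if "prec_comp G b A B C1 C2" "C1 \<in> J" "C2 \<in> I" for C1 C2
  proof -
    have "le_comp G b A B C1 C2" using that by (auto simp: le_comp_def)
    then show False
      using that un disj I unfolding normalized_lower_ideal_def lower_ideal_def by blast
  qed
  have inc: "?c v \<in> inconsistent_hooked_up G b W" if "v \<in> D_set G b" "v \<in> W" for v W
  proof -
    have "v \<in> verts G" using that by (auto simp: D_set_def)
    then show ?thesis
      using c[of v] that unfolding inconsistent_hooked_up_def loose_component_def by blast
  qed
  \<comment> \<open>The component of such a vertex is hooked up by the color class of the vertex,
    and normalization sends it to the ideal that contributes this class to \<open>Z\<close>.\<close>
  have "D_set G b \<subseteq> Z"
  proof
    fix v assume v: "v \<in> D_set G b"
    then have "v \<in> A \<union> B" using AB by (auto simp: D_set_def)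
    then show "v \<in> Z"
      using inc[OF v] I J ZA[of v] ZB[of v]
      unfolding normalized_lower_ideal_def normalized_upper_ideal_def by blast
  qed
  moreover have "e \<in> forbidden_edges G b" if eY: "e \<in> edges_within G (verts G - Z)" for e
  proof (rule ccontr)
    assume nf: "e \<notin> forbidden_edges G b"
    obtain x y where xy: "x \<in> A" "y \<in> B" "ends G e = {x, y}" "x \<notin> Z" "y \<notin> Z" and e: "e \<in> edges G"
      using eY G by (fastforce simp: edges_within_def finite_bipartite_graph_def)
    have V: "x \<in> verts G" "y \<in> verts G" using xy AB by auto
    then have "?c x \<in> I \<union> J" "?c y \<in> I \<union> J" using un c(1) by auto
    \<comment> \<open>Missing \<open>Z\<close> puts the end in \<open>A\<close> on the
      \<open>J\<close> side and the end in \<open>B\<close> on the \<open>I\<close> side. An edge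
      that is not forbidden is then inevitable and points from \<open>J\<close> to
      \<open>I\<close>.\<close>
    then have side: "?c x \<in> J" "?c y \<in> I" using xy ZA ZB by auto
    then have "e \<notin> flexible_edges G b"
      using flexible_component_of_edge[OF _ xy(3) V] disj by fastforce
    then have "e \<in> inevitable_edges G b"
      using nf e by (auto simp: forbidden_edges_def flexible_edges_def)
    then have "prec_comp G b A B (?c x) (?c y)"
      unfolding prec_comp_def joins_def using xy c[OF V(1)] c[OF V(2)] by blast
    then show False using side le by blast
  qed
  moreover have "e \<in> inevitable_edges G b" if eZ: "e \<in> edges_within G Z" for e
  proof (rule ccontr)
    assume ni: "e \<notin> inevitable_edges G b"
    obtain x y where xy: "x \<in> A" "y \<in> B" "ends G e = {x, y}" "x \<in> Z" "y \<in> Z" and e: "e \<in> edges G"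
      using eZ G by (fastforce simp: edges_within_def finite_bipartite_graph_def)
    have V: "x \<in> verts G" "y \<in> verts G" using xy AB by auto
    have side: "?c x \<in> I" "?c y \<in> J" using xy ZA ZB by auto
    then have "e \<notin> flexible_edges G b"
      using flexible_component_of_edge[OF _ xy(3) V] disj by fastforce
    then have "e \<in> forbidden_edges G b"
      using ni e by (auto simp: forbidden_edges_def flexible_edges_def)
    \<comment> \<open>Forbidden edges order components from the B-end to the A-end, so again a
      component of \<open>J\<close> precedes one of \<open>I\<close>.\<close>
    then have "prec_comp G b A B (?c y) (?c x)"
      unfolding prec_comp_def joins_def using xy c[OF V(1)] c[OF V(2)] by blast
    then show False using side le by blast
  qed
  ultimately show ?thesis using b_verifying_iff[OF G Z] by blast
qed

theorem mainTheorem2: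
  fixes G :: "('v, 'e) graph" and A B Z :: "'v set" and b :: "'v \<Rightarrow> nat"
  assumes "finite_bipartite_graph G A B"
    and "Z \<subseteq> verts G"
  shows "b_verifying G b Z \<longleftrightarrow>
    (\<exists>I\<^sub>A I\<^sub>B.
       normalized_lower_ideal G b A B I\<^sub>A \<and> normalized_upper_ideal G b A B I\<^sub>B \<and>
       I\<^sub>A \<union> I\<^sub>B = flexible_components G b \<and> I\<^sub>A \<inter> I\<^sub>B = {} \<and>
       Z = (\<Union>H\<in>I\<^sub>A. verts H \<inter> A) \<union> (\<Union>H\<in>I\<^sub>B. verts H \<inter> B))"
    (is "_ \<longleftrightarrow> ?ideals")
proof
  assume "b_verifying G b Z"
  note ideals = b_verifying_imp_ideals[OF assms this]
  show ?ideals
    by (intro exI conjI) (rule ideals)+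
next
  assume ?ideals
  then show "b_verifying G b Z"
    by (elim exE conjE) (rule ideals_imp_b_verifying[OF assms])
qed

end
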